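(* Let $n \geq 1$ be an integer. Then the function $F_n : [0,1] \to \mathbb{R}$ defined by $$F_n(x) = \sum_{k=0}^n \left( \binom{n}{k} x^k (1-x)^{n-k} \right)^2$$ is log-convex on $[0,1]$.
   Context: The convention $0^0 = 1$ is used, so that $F_n(0) = F_n(1) = 1$; the function $F_n$ is strictly positive on $[0,1]$. A strictly positive function $f$ on an interval $I$ is called log-convex (logarithmically convex) on $I$ if $\log f$ is convex on $I$. *)

theory Defs
  imports "HOL-Analysis.Analysis"
begin

definition log_convex_on :: "real set \<Rightarrow> (real \<Rightarrow> real) \<Rightarrow> bool" where
  "log_convex_on I f \<longleftrightarrow> (\<forall>x\<in>I. f x > 0) \<and> convex_on I (\<lambda>x. ln (f x))"

text \<open>The formula defines a function on all reals; the paper's function is its restriction to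
  \<open>{0..1}\<close>. The library convention \<open>0 ^ 0 = 1\<close> gives \<open>F n 0 = F n 1 = 1\<close>.\<close>

definition F :: "nat \<Rightarrow> real \<Rightarrow> real" where
  "F n x = (\<Sum>k = 0..n. (real (n choose k) * x ^ k * (1 - x) ^ (n - k)) ^ 2)"

end

theory Submission
  imports Defs
begin

text \<open>Let \<open>M\<^sub>i\<close> be the sum of \<open>(k - n x)\<^sup>i B\<^sub>k(x)\<^sup>2\<close> over the Bernstein polynomials \<open>B\<^sub>k\<close> of degree \<open>n\<close>,
  so that \<open>F = M\<^sub>0\<close>, and put \<open>p = x (1 - x)\<close>, \<open>u = 2 x - 1\<close>. Since \<open>p B\<^sub>k' = (k - n x) B\<^sub>k\<close>, the
  derivatives of \<open>F\<close> are combinations of \<open>M\<^sub>0, M\<^sub>1, M\<^sub>2\<close>, and the relation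
  \<open>u M\<^sub>2 = 2 n p M\<^sub>1\<close> turns this into a linear second-order equation for \<open>F\<close>. Equivalently,
  \<open>L = F'/F\<close> solves the Riccati equation \<open>p u L' = - S\<close> with
  \<open>S = p u L\<^sup>2 - (4 n p + u\<^sup>2) L + 2 n u\<close>, and we need \<open>S \<le> 0\<close> on \<open>(1/2, 1)\<close>; the rest follows
  by symmetry and continuity. The bounds \<open>0 \<le> L\<close> and \<open>u L \<le> 2 n\<close> give
  \<open>\<partial>S/\<partial>x > 0 > \<partial>S/\<partial>L\<close>. Where \<open>S > 0\<close> we have \<open>L' < 0\<close>, so \<open>S\<close> increases there; a positive
  value of \<open>S\<close> would therefore persist up to \<open>x = 1\<close>, where \<open>S = 0\<close>.\<close>

section \<open>Bernstein moments and the differential equation for \<open>F\<close>\<close>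

definition bernstein_poly :: "nat \<Rightarrow> nat \<Rightarrow> real poly" where
  "bernstein_poly n k = of_nat (n choose k) * [:0, 1:] ^ k * [:1, -1:] ^ (n - k)"

definition bernstein_moment :: "nat \<Rightarrow> nat \<Rightarrow> real poly" where
  "bernstein_moment n i = (\<Sum>k\<le>n. [:real k, - real n:] ^ i * (bernstein_poly n k)\<^sup>2)"

lemma poly_bernstein_moment:
  "poly (bernstein_moment n i) x =
     (\<Sum>k\<le>n. (real k - real n * x) ^ i * (real (n choose k) * x ^ k * (1 - x) ^ (n - k))\<^sup>2)"
  by (simp add: bernstein_moment_def bernstein_poly_def poly_sum mult.commute)

lemma F_eq_poly: "F n x = poly (bernstein_moment n 0) x"
  by (simp add: F_def poly_bernstein_moment atMost_atLeast0)

text \<open>The extra factor \<open>p\<close> keeps the exponent at \<open>k\<close>, so that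
  \<open>k - 1\<close> and a case split at \<open>k = 0\<close> do not spread further.\<close>

lemma mult_pderiv_power:
  fixes p :: "real poly"
  shows "p * pderiv (p ^ k) = of_nat k * p ^ k * pderiv p"
  by (cases k) (simp_all add: pderiv_power_Suc of_nat_poly algebra_simps del: power_Suc, simp add: mult_ac)

text \<open>The logarithmic derivative is \<open>k / x - (n - k) / (1 - x)\<close>; times
  \<open>x (1 - x)\<close> this is \<open>k (1 - x) - (n - k) x = k - n x\<close>.\<close>

lemma bernstein_poly_pderiv:
  assumes "k \<le> n"
  shows "[:0, 1:] * [:1, -1:] * pderiv (bernstein_poly n k) = [:real k, - real n:] * bernstein_poly n k"
proof -
  define X Y :: "real poly" where "X = [:0, 1:]" and "Y = [:1, -1:]"
  define c :: "real poly" where "c = of_nat (n choose k)"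
  have X: "X * pderiv (X ^ k) = of_nat k * X ^ k"
    by (simp add: mult_pderiv_power) (simp add: X_def pderiv_pCons)
  have Y: "Y * pderiv (Y ^ (n - k)) = - (of_nat (n - k) * Y ^ (n - k))"
    by (simp add: mult_pderiv_power) (simp add: Y_def pderiv_pCons one_pCons[symmetric])
  have "X * Y * pderiv (c * X ^ k * Y ^ (n - k)) =
      c * (Y * Y ^ (n - k) * (X * pderiv (X ^ k)) + X * X ^ k * (Y * pderiv (Y ^ (n - k))))"
    by (simp add: c_def pderiv_mult algebra_simps)
  also have "\<dots> = (of_nat k * Y - of_nat (n - k) * X) * (c * X ^ k * Y ^ (n - k))"
    unfolding X Y by (simp add: algebra_simps)
  also have "of_nat k * Y - of_nat (n - k) * X = [:real k, - real n:]"
    using assms by (simp add: X_def Y_def of_nat_poly of_nat_diff)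
  finally show ?thesis
    by (simp only: bernstein_poly_def X_def Y_def c_def)
qed

lemma moment0_pderiv:
  "[:0, 1:] * [:1, -1:] * pderiv (bernstein_moment n 0) = 2 * bernstein_moment n 1"
proof -
  have "[:0, 1:] * [:1, -1:] * pderiv ((bernstein_poly n k)\<^sup>2) =
      2 * ([:real k, - real n:] * (bernstein_poly n k)\<^sup>2)" if "k \<le> n" for k
  proof -
    have "[:0, 1:] * [:1, -1:] * pderiv ((bernstein_poly n k)\<^sup>2) =
        2 * bernstein_poly n k * ([:0, 1:] * [:1, -1:] * pderiv (bernstein_poly n k))"
      by (simp only: power2_eq_square pderiv_mult) (simp only: algebra_simps mult_2)
    then show ?thesis
      unfolding bernstein_poly_pderiv[OF that] by (simp only: power2_eq_square mult_ac)
  qed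
  then show ?thesis
    by (simp add: bernstein_moment_def higher_pderiv_sum[where n = 1, simplified] sum_distrib_left del: mult_pCons_left mult_pCons_right)
qed

lemma moment1_pderiv:
  "[:0, 1:] * [:1, -1:] * pderiv (bernstein_moment n 1) =
     2 * bernstein_moment n 2 - of_nat n * [:0, 1:] * [:1, -1:] * bernstein_moment n 0"
proof -
  have "[:0, 1:] * [:1, -1:] * pderiv ([:real k, - real n:] * (bernstein_poly n k)\<^sup>2) =
      2 * ([:real k, - real n:]\<^sup>2 * (bernstein_poly n k)\<^sup>2)
        - of_nat n * [:0, 1:] * [:1, -1:] * (bernstein_poly n k)\<^sup>2" if "k \<le> n" for k
  proof -
    have D: "pderiv [:real k, - real n:] = - of_nat n"
      by (simp add: pderiv_pCons of_nat_poly)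
    have "[:0, 1:] * [:1, -1:] * pderiv ([:real k, - real n:] * (bernstein_poly n k)\<^sup>2) =
        2 * [:real k, - real n:] * bernstein_poly n k * ([:0, 1:] * [:1, -1:] * pderiv (bernstein_poly n k))
         + pderiv [:real k, - real n:] * [:0, 1:] * [:1, -1:] * (bernstein_poly n k)\<^sup>2"
      by (simp only: power2_eq_square pderiv_mult) (simp only: algebra_simps mult_2)
    then show ?thesis
      unfolding bernstein_poly_pderiv[OF that] D
      by (simp only: power2_eq_square mult_ac minus_mult_left[symmetric] diff_conv_add_uminus mult_minus_left mult_minus_right)
  qed
  then show ?thesis
    by (simp add: bernstein_moment_def higher_pderiv_sum[where n = 1, simplified] sum_distrib_left sum_subtractf
        del: mult_pCons_left mult_pCons_right)
qed

text \<open>Squaring \<open>(k + 1) (1 - x) B\<^bsub>k+1\<^esub> = (n - k) x B\<^sub>k\<close> and summing shows that the sum of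
  \<open>((k (1 - x))\<^sup>2 - ((n - k) x)\<^sup>2) B\<^sub>k\<^sup>2\<close> vanishes; the first factor of this difference of squares is
  \<open>k - n x\<close>.\<close>

lemma moment_relation:
  "(1 - 2 * x) * poly (bernstein_moment n 2) x
     + 2 * real n * x * (1 - x) * poly (bernstein_moment n 1) x = 0"
proof -
  define b where "b k = real (n choose k) * x ^ k * (1 - x) ^ (n - k)" for k
  have step: "real (Suc k) * (1 - x) * b (Suc k) = real (n - k) * x * b k" if "k < n" for k
  proof -
    have c: "real (Suc k) * real (n choose Suc k) = real (n - k) * real (n choose k)"
      by (metis binomial_absorb_comp binomial_absorption of_nat_mult)
    have "n - k = Suc (n - Suc k)" using that by simp
    then have "real (Suc k) * (1 - x) * b (Suc k) =
        (real (Suc k) * real (n choose Suc k)) * x * x ^ k * (1 - x) ^ (n - k)"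
      by (simp add: b_def)
    then show ?thesis
      unfolding c by (simp add: b_def)
  qed
  have "(\<Sum>k\<le>n. (real k * (1 - x) * b k)\<^sup>2) = (\<Sum>k\<le>n. (real (n - k) * x * b k)\<^sup>2)"
  proof (cases n)
    case (Suc m)
    \<comment> \<open>The index shift loses nothing: the left summand vanishes at
      \<open>k = 0\<close>, the right one at \<open>k = n\<close>.\<close>
    have "(\<Sum>k\<le>n. (real k * (1 - x) * b k)\<^sup>2) = (\<Sum>k\<le>m. (real (Suc k) * (1 - x) * b (Suc k))\<^sup>2)"
      unfolding Suc sum.atMost_Suc_shift by simp
    also have "\<dots> = (\<Sum>k\<le>m. (real (n - k) * x * b k)\<^sup>2)"
      by (intro sum.cong refl, subst step) (auto simp: Suc)
    also have "\<dots> = (\<Sum>k\<le>n. (real (n - k) * x * b k)\<^sup>2)"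
      by (simp add: Suc)
    finally show ?thesis .
  qed simp
  then have "0 = (\<Sum>k\<le>n. (real k * (1 - x) * b k)\<^sup>2 - (real (n - k) * x * b k)\<^sup>2)"
    by (simp add: sum_subtractf)
  also have "\<dots> = (\<Sum>k\<le>n. (1 - 2 * x) * ((real k - real n * x)\<^sup>2 * (b k)\<^sup>2)
      + 2 * real n * x * (1 - x) * ((real k - real n * x) * (b k)\<^sup>2))"
    by (intro sum.cong refl) (auto simp: of_nat_diff power2_eq_square algebra_simps)
  also have "\<dots> = (1 - 2 * x) * poly (bernstein_moment n 2) x
     + 2 * real n * x * (1 - x) * poly (bernstein_moment n 1) x"
    unfolding poly_bernstein_moment b_def by (simp add: sum.distrib sum_distrib_left)
  finally show ?thesis by simp
qed

text \<open>Differentiating \<open>p P' = 2 M_1\<close> once more brings in \<open>M_2\<close>;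
  \<open>moment_relation\<close> then eliminates both moments. The result still carries a factor
  \<open>p\<close>, which is cancelled between polynomials, so the equation also holds at the zeros
  of \<open>p\<close>. Its validity at \<open>x = 1\<close> is needed later.\<close>

lemma F_ode:
  fixes n :: nat and x :: real
  defines "P \<equiv> bernstein_moment n 0"
  shows "x * (1 - x) * (2 * x - 1) * poly (pderiv (pderiv P)) x =
     (4 * real n * x * (1 - x) + (2 * x - 1)\<^sup>2) * poly (pderiv P) x - 2 * real n * (2 * x - 1) * poly P x"
proof -
  define p :: "real poly" where "p = [:0, 1:] * [:1, -1:]"
  define u :: "real poly" where "u = [:-1, 2:]"
  define Q where "Q = p * u * pderiv (pderiv P) - (4 * of_nat n * p + u\<^sup>2) * pderiv P + 2 * of_nat n * u * P"
  have pe: "poly p y = y * (1 - y)" and ue: "poly u y = 2 * y - 1" for y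
    by (simp_all add: p_def u_def algebra_simps)
  have p': "pderiv p = - u"
    by (simp add: p_def u_def pderiv_pCons)
  have "poly p y * poly Q y = 0" for y
  proof -
    have 1: "poly p y * poly (pderiv P) y = 2 * poly (bernstein_moment n 1) y"
      using arg_cong[OF moment0_pderiv[of n], of "\<lambda>q. poly q y"]
      unfolding P_def p_def poly_mult by simp
    have "p * pderiv (p * pderiv P) = 2 * (2 * bernstein_moment n 2 - of_nat n * p * P)"
    proof -
      have "p * pderiv (p * pderiv P) = 2 * (p * pderiv (bernstein_moment n 1))"
        unfolding P_def p_def moment0_pderiv by (simp add: pderiv_mult)
      then show ?thesis
        unfolding p_def moment1_pderiv P_def by (simp only: mult.assoc)
    qed
    then have "poly (p * pderiv (p * pderiv P)) y = poly (2 * (2 * bernstein_moment n 2 - of_nat n * p * P)) y"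
      by simp
    then have 2: "poly p y * (poly p y * poly (pderiv (pderiv P)) y - poly u y * poly (pderiv P) y)
        = 4 * poly (bernstein_moment n 2) y - 2 * real n * poly p y * poly P y"
      by (simp add: pderiv_mult p' algebra_simps)
    have "poly u y * poly (bernstein_moment n 2) y = 2 * real n * poly p y * poly (bernstein_moment n 1) y"
      using moment_relation[of y n] unfolding pe ue by (simp add: algebra_simps)
    with 1 2 show ?thesis
      unfolding Q_def poly_add poly_diff poly_mult poly_power poly_of_nat poly_numeral by algebra
  qed
  then have "p * Q = 0"
    by (subst poly_all_0_iff_0[symmetric]) simp
  moreover have "p \<noteq> 0" by (simp add: p_def)
  ultimately have "poly Q x = 0" by simp
  then show ?thesis
    unfolding Q_def by (simp add: pe ue algebra_simps)
qed

section \<open>Positivity, symmetry and the inequalities behind the Riccati argument\<close>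

lemma F_pos: "F n x > 0"
proof (cases "x = 0")
  case True
  then have "F n x = (\<Sum>k=0..n. if k = 0 then 1 else 0)"
    unfolding F_def by (intro sum.cong) auto
  then show ?thesis by simp
next
  case False
  have "0 < (real (n choose n) * x ^ n * (1 - x) ^ (n - n))\<^sup>2"
    using False by simp
  also have "\<dots> \<le> F n x"
    unfolding F_def by (intro member_le_sum) auto
  finally show ?thesis .
qed

lemma F_reflect: "F n (1 - x) = F n x"
proof -
  have "F n (1 - x) = (\<Sum>k=0..n. (real (n choose (n - k)) * (1 - x) ^ (n - k) * x ^ (n - (n - k)))\<^sup>2)"
    unfolding F_def by (subst sum.atLeastAtMost_rev) (simp add: atLeast0AtMost)
  also have "\<dots> = F n x"
    unfolding F_def by (intro sum.cong refl) (auto simp: binomial_symmetric[symmetric] mult_ac)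
  finally show ?thesis .
qed

text \<open>By \<open>moment_relation\<close>, \<open>M_1\<close> inherits the sign of
  \<open>u M_2 >= 0\<close>. The second bound holds term by term:
  \<open>k - n x <= n (1 - x)\<close> and \<open>u <= x\<close>, so
  \<open>u (k - n x) <= n p\<close>.\<close>

lemma F_deriv_bounds:
  assumes "1/2 < x" "x < 1"
  shows "poly (pderiv (bernstein_moment n 0)) x \<ge> 0"
    and "(2 * x - 1) * poly (pderiv (bernstein_moment n 0)) x \<le> 2 * real n * F n x"
proof -
  define M where "M i = poly (bernstein_moment n i) x" for i
  define p where "p = x * (1 - x)"
  have p: "p > 0" using assms by (simp add: p_def)
  have d: "p * poly (pderiv (bernstein_moment n 0)) x = 2 * M 1"
    using arg_cong[OF moment0_pderiv[of n], of "\<lambda>q. poly q x"]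
    unfolding poly_mult M_def p_def by simp
  have M2: "M 2 \<ge> 0"
    unfolding M_def poly_bernstein_moment by (intro sum_nonneg) auto
  show "poly (pderiv (bernstein_moment n 0)) x \<ge> 0"
  proof (cases "n = 0")
    case True
    then show ?thesis by (simp add: bernstein_moment_def bernstein_poly_def)
  next
    case False
    have "2 * real n * p * M 1 = (2 * x - 1) * M 2"
      using moment_relation[of x n] by (simp add: M_def p_def algebra_simps)
    also have "\<dots> \<ge> 0" using M2 assms by simp
    finally have "0 \<le> (2 * real n * p) * M 1" .
    moreover have "2 * real n * p > 0" using False p by simp
    ultimately have "M 1 \<ge> 0" by (simp only: zero_le_mult_iff) linarith
    then have "0 \<le> p * poly (pderiv (bernstein_moment n 0)) x" using d by simp
    with p show ?thesis by (simp only: zero_le_mult_iff) linarith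
  qed
  have "(2 * x - 1) * (real k - real n * x) \<le> real n * p" if "k \<le> n" for k
  proof -
    have "(2 * x - 1) * (real k - real n * x) \<le> (2 * x - 1) * (real n - real n * x)"
      using assms that by (intro mult_left_mono) auto
    also have "\<dots> = (2 * x - 1) * (real n * (1 - x))" by (simp add: algebra_simps)
    also have "\<dots> \<le> x * (real n * (1 - x))"
      using assms by (intro mult_right_mono) auto
    finally show ?thesis by (simp add: p_def mult_ac)
  qed
  then have "(2 * x - 1) * M 1 \<le> real n * p * F n x"
    unfolding M_def F_eq_poly poly_bernstein_moment sum_distrib_left mult.assoc[symmetric]
    by (intro sum_mono mult_right_mono) auto
  then have "(2 * x - 1) * (p * poly (pderiv (bernstein_moment n 0)) x) \<le> p * (2 * real n * F n x)"
    unfolding d by (simp add: algebra_simps)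
  then show "(2 * x - 1) * poly (pderiv (bernstein_moment n 0)) x \<le> 2 * real n * F n x"
    using p by (simp add: mult.left_commute[of _ p])
qed

text \<open>The left-hand side is \<open>\<partial>S/\<partial>x\<close>. Multiplied by \<open>q = u\<^sup>2\<close> it depends only on \<open>q\<close> and
  \<open>w = u * L\<close>; if \<open>3 * q > 1\<close> it is concave in \<open>w\<close>, so that the ends of \<open>0 \<le> w \<le> 2 * n\<close> decide.\<close>

lemma riccati_partial_pos:
  fixes u L n :: real
  assumes n: "n \<ge> 1" and u: "0 < u" "u < 1" and L: "0 \<le> L" "u * L \<le> 2 * n"
  shows "(1 - 3 * u\<^sup>2) / 2 * L\<^sup>2 + 4 * u * (n - 1) * L + 4 * n > 0"
proof -
  define q w where "q = u\<^sup>2" and "w = u * L"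
  have q: "0 < q" "q < 1" using u by (simp_all add: q_def power_less_one_iff)
  have w: "0 \<le> w" "w \<le> 2 * n" using u L by (simp_all add: w_def)
  have "(1 - 3 * q) / 2 * w\<^sup>2 + 4 * q * (n - 1) * w + 4 * n * q > 0"
  proof (cases "1 - 3 * q \<ge> 0")
    case True
    then have "(1 - 3 * q) / 2 * w\<^sup>2 \<ge> 0" "4 * q * (n - 1) * w \<ge> 0" "4 * n * q > 0"
      using n q w by simp_all
    then show ?thesis by linarith
  next
    case False
    \<comment> \<open>Replacing \<open>w^2\<close> by \<open>2 * n * w\<close> passes to the chord
      of the concave function, written below with the weights \<open>2 * n - w\<close> and
      \<open>w\<close> of the two ends.\<close>
    have "w\<^sup>2 \<le> 2 * n * w" unfolding power2_eq_square using w by (intro mult_right_mono) auto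
    then have "(1 - 3 * q) / 2 * w\<^sup>2 \<ge> (1 - 3 * q) / 2 * (2 * n * w)"
      using False by (intro mult_left_mono_neg) auto
    moreover have "(1 - 3 * q) / 2 * (2 * n * w) + 4 * q * (n - 1) * w + 4 * n * q =
        (2 * n - w) * (2 * q) + w * (n * (1 + q) - 2 * q)"
      by (simp add: field_simps)
    moreover have "(2 * n - w) * (2 * q) + w * (n * (1 + q) - 2 * q) > 0"
    proof (cases "w = 0")
      case False
      have "2 * q < 1 * (1 + q)" using q by simp
      also have "\<dots> \<le> n * (1 + q)" using n q by (intro mult_right_mono) auto
      finally have "n * (1 + q) - 2 * q > 0" by simp
      then have "w * (n * (1 + q) - 2 * q) > 0" using False w by (intro mult_pos_pos) auto
      moreover have "(2 * n - w) * (2 * q) \<ge> 0" using w q by simp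
      ultimately show ?thesis by linarith
    qed (use n q in simp)
    ultimately show ?thesis by linarith
  qed
  also have "(1 - 3 * q) / 2 * w\<^sup>2 + 4 * q * (n - 1) * w + 4 * n * q =
      u\<^sup>2 * ((1 - 3 * u\<^sup>2) / 2 * L\<^sup>2 + 4 * u * (n - 1) * L + 4 * n)"
    by (simp add: q_def w_def power2_eq_square algebra_simps)
  finally show ?thesis using u by (simp add: zero_less_mult_iff)
qed

text \<open>If \<open>f a > 0\<close>, the maximum over \<open>{a..b}\<close> is positive and hence
  attained before \<open>b\<close>; a positive derivative there yields a larger value to its
  right.\<close>

lemma nonpos_if_increasing_where_pos:
  fixes f :: "real \<Rightarrow> real"
  assumes cont: "continuous_on {a..b} f" and b: "f b \<le> 0" and a: "a \<le> b"
    and deriv: "\<And>x. a \<le> x \<Longrightarrow> x < b \<Longrightarrow> f x > 0 \<Longrightarrow> \<exists>d>0. (f has_real_derivative d) (at x)"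
  shows "f a \<le> 0"
proof (rule ccontr)
  assume pos: "\<not> f a \<le> 0"
  obtain m where m: "m \<in> {a..b}" and max: "\<And>y. y \<in> {a..b} \<Longrightarrow> f y \<le> f m"
    using continuous_attains_sup[OF compact_Icc _ cont] a by auto
  have fm: "f m > 0" using max[of a] a pos by simp
  have mb: "m < b" using m fm b by (cases "m = b") auto
  obtain d where "d > 0" "(f has_real_derivative d) (at m)"
    using deriv[of m] m mb fm by auto
  then obtain e where e: "e > 0" "\<And>h. h > 0 \<Longrightarrow> h < e \<Longrightarrow> f m < f (m + h)"
    using DERIV_pos_inc_right by blast
  define h where "h = min (e / 2) (b - m)"
  have "h > 0" "h < e" "m + h \<in> {a..b}" using e(1) mb m by (auto simp: h_def min_def)
  with e(2)[of h] max[of "m + h"] show False by force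
qed

section \<open>The Riccati argument on (1/2, 1)\<close>

lemma F_log_convex_right:
  assumes n: "n \<ge> 1" and x: "1/2 < x" "x < 1"
  defines "P \<equiv> bernstein_moment n 0"
  shows "poly P x * poly (pderiv (pderiv P)) x - (poly (pderiv P) x)\<^sup>2 \<ge> 0"
proof -
  define L L' where "L y = poly (pderiv P) y / poly P y"
    and "L' y = poly (pderiv (pderiv P)) y / poly P y - (L y)\<^sup>2" for y
  define p :: "real \<Rightarrow> real" where "p y = y * (1 - y)" for y
  define u :: "real \<Rightarrow> real" where "u y = 2 * y - 1" for y
  define S where "S y = p y * u y * (L y)\<^sup>2 - (4 * real n * p y + (u y)\<^sup>2) * L y + 2 * real n * u y" for y
  have P: "poly P y > 0" for y
    using F_pos[of n y] by (simp add: F_eq_poly P_def)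
  have dL: "(L has_real_derivative L' y) (at y)" for y
    unfolding L_def L'_def using P[of y]
    by (auto intro!: derivative_eq_intros simp: power2_eq_square field_simps)
  have ric: "S y = - (p y * u y * L' y)" for y
  proof -
    have "p y * u y * (poly (pderiv (pderiv P)) y / poly P y) =
       (4 * real n * p y + (u y)\<^sup>2) * L y - 2 * real n * u y"
      using F_ode[of y n] P[of y] unfolding P_def[symmetric] L_def p_def u_def
      by (simp add: field_simps)
    then show ?thesis unfolding S_def L'_def by (simp add: algebra_simps)
  qed
  \<comment> \<open>Chain rule: the first summand is the partial derivative of \<open>S\<close> in
    \<open>y\<close>, simplified by \<open>p = (1 - u^2) / 4\<close>; the factor of
    \<open>L' y\<close> is the partial derivative in \<open>L\<close>.\<close>
  have dS: "(S has_real_derivative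
      ((1 - 3 * (u y)\<^sup>2) / 2 * (L y)\<^sup>2 + 4 * u y * (real n - 1) * L y + 4 * real n)
      + (2 * p y * u y * L y - (4 * real n * p y + (u y)\<^sup>2)) * L' y) (at y)" for y
    unfolding S_def p_def u_def
    by (rule derivative_eq_intros dL refl)+ (simp add: power2_eq_square field_simps)
  have "S x \<le> 0"
  proof (rule nonpos_if_increasing_where_pos[of x 1])
    show "continuous_on {x..1} S"
      using dS by (intro DERIV_continuous_on) (auto intro: has_field_derivative_at_within)
    \<comment> \<open>\<open>ric\<close> holds at the endpoint too, and \<open>p 1 = 0\<close> gives
      \<open>S 1 = 0\<close>.\<close>
    show "S 1 \<le> 0" by (simp add: ric p_def)
    fix y assume y: "x \<le> y" "y < 1" and Sy: "S y > 0"
    have py: "p y > 0" and uy: "0 < u y" "u y < 1"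
      using x y by (simp_all add: p_def u_def)
    have L: "L y \<ge> 0" "u y * L y \<le> 2 * real n"
      using F_deriv_bounds[of y n] x y P[of y]
      by (simp_all add: L_def u_def P_def F_eq_poly field_simps)
    have "L' y < 0"
      using Sy py uy unfolding ric by (simp add: mult_less_0_iff)
    moreover have "2 * p y * u y * L y - (4 * real n * p y + (u y)\<^sup>2) < 0"
    proof -
      have "2 * p y * (u y * L y) \<le> 2 * p y * (2 * real n)"
        using L py by (intro mult_left_mono) auto
      moreover have "(u y)\<^sup>2 > 0" using uy by simp
      moreover have "2 * p y * u y * L y = 2 * p y * (u y * L y)"
          "2 * p y * (2 * real n) = 4 * real n * p y"
        by simp_all
      ultimately show ?thesis by linarith
    qed
    ultimately have "(2 * p y * u y * L y - (4 * real n * p y + (u y)\<^sup>2)) * L' y > 0"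
      by (rule mult_neg_neg[rotated])
    moreover have "(1 - 3 * (u y)\<^sup>2) / 2 * (L y)\<^sup>2 + 4 * u y * (real n - 1) * L y + 4 * real n > 0"
      using riccati_partial_pos[of "real n" "u y" "L y"] n uy L by simp
    ultimately show "\<exists>d>0. (S has_real_derivative d) (at y)"
      using dS[of y] add_pos_pos by blast
  qed (use x in simp)
  moreover have "p x * u x > 0" using x by (simp add: p_def u_def)
  ultimately have "L' x \<ge> 0" unfolding ric by (simp add: zero_le_mult_iff)
  then have "(poly P x)\<^sup>2 * L' x \<ge> 0" by simp
  also have "(poly P x)\<^sup>2 * L' x = poly P x * poly (pderiv (pderiv P)) x - (poly (pderiv P) x)\<^sup>2"
    using P[of x] by (simp add: L'_def L_def power2_eq_square field_simps)
  finally show ?thesis .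
qed

section \<open>Extension to [0, 1] by continuity and symmetry\<close>

theorem theorem2p1:
  fixes n :: nat
  assumes "n \<ge> 1"
  shows "log_convex_on {0..1} (F n)"
proof -
  define P where "P = bernstein_moment n 0"
  define W where "W y = poly P y * poly (pderiv (pderiv P)) y - (poly (pderiv P) y)\<^sup>2" for y
  have P: "poly P y > 0" for y
    using F_pos[of n y] by (simp add: F_eq_poly P_def)
  \<comment> \<open>Continuity adds the points 1/2 and 1, where \<open>p u\<close> vanishes and the
    sign of \<open>S\<close> says nothing about \<open>L'\<close>.\<close>
  have W_right: "W y \<ge> 0" if "y \<in> {1/2..1}" for y
  proof (rule continuous_ge_on_closure[of "{1/2<..<1}" W])
    show "continuous_on (closure {1/2<..<1}) W"
      unfolding W_def by (intro continuous_intros)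
    show "y \<in> closure {1/2<..<1}" using that by simp
    show "W z \<ge> 0" if "z \<in> {1/2<..<1}" for z
      using F_log_convex_right[OF assms, of z] that by (simp add: W_def P_def)
  qed
  have W_reflect: "W (1 - y) = W y" for y
  proof -
    \<comment> \<open>As an identity of polynomials the symmetry can be differentiated;
      \<open>P'\<close> changes sign but enters \<open>W\<close> only squared.\<close>
    have "pcompose P [:1, -1:] = P"
      by (subst poly_eq_poly_eq_iff[symmetric])
        (use F_reflect[of n] in \<open>auto simp: poly_pcompose P_def F_eq_poly\<close>)
    then have P0: "P = pcompose P [:1, -1:]" ..
    have P1: "pderiv P = - pcompose (pderiv P) [:1, -1:]"
      by (subst P0, subst pderiv_pcompose) (simp add: pderiv_pCons)
    have P2: "pderiv (pderiv P) = pcompose (pderiv (pderiv P)) [:1, -1:]"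
      by (subst P1, subst pderiv_minus, subst pderiv_pcompose) (simp add: pderiv_pCons)
    have "poly P y = poly P (1 - y)" "poly (pderiv P) y = - poly (pderiv P) (1 - y)"
      "poly (pderiv (pderiv P)) y = poly (pderiv (pderiv P)) (1 - y)"
      by (subst P0 P1 P2, simp add: poly_pcompose)+
    then show ?thesis by (simp add: W_def)
  qed
  have W: "W y \<ge> 0" if "y \<in> {0..1}" for y
    using W_right[of y] W_right[of "1 - y"] W_reflect[of y] that by (cases "y \<ge> 1/2") auto
  have "convex_on {0..1} (\<lambda>y. ln (poly P y))"
  proof (rule f''_ge0_imp_convex)
    show "((\<lambda>y. ln (poly P y)) has_real_derivative poly (pderiv P) y / poly P y) (at y)" for y
      using P[of y] by (auto intro!: derivative_eq_intros)
    show "((\<lambda>y. poly (pderiv P) y / poly P y) has_real_derivative W y / (poly P y)\<^sup>2) (at y)" for y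
      using P[of y] unfolding W_def
      by (auto intro!: derivative_eq_intros simp: power2_eq_square field_simps)
    show "W y / (poly P y)\<^sup>2 \<ge> 0" if "y \<in> {0..1}" for y
      using W[OF that] by simp
  qed simp
  then show ?thesis
    unfolding log_convex_on_def using F_pos by (simp add: F_eq_poly P_def)
qed

end
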